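(* Let $G$ be a connected graph with vertex set $\{1,\dots,n\}$, $n\ge 2$, let $\Phi=(F_1,\dots,F_n)$ be an $n$-tuple of pairwise disjoint graphs, and let $G[\Phi]$ be the generalized lexicographic product. If $\gamma(F_i)\ge 2$ for all $i$, then $\gamma(G[\Phi])=\gamma_r(G[\Phi])=\gamma_t(G[\Phi])=\gamma_{tr}(G[\Phi])=\gamma^{oc}(G[\Phi])=\gamma_t^{oc}(G[\Phi])$. If $\gamma(F_i)\ge 3$ for all $i$, then $\gamma(G[\Phi])\equiv\gamma_r(G[\Phi])\equiv\gamma_t(G[\Phi])\equiv\gamma_{tr}(G[\Phi])\equiv\gamma^{oc}(G[\Phi])\equiv\gamma_t^{oc}(G[\Phi])$.
   Context: All graphs are finite, simple and undirected. The generalized lexicographic product $G[\Phi]$ is the graph with vertex set $\bigcup_{i=1}^n V(F_i)$ in which each $F_i$ is an induced subgraph, and for $x\in V(F_i)$, $y\in V(F_j)$ with $i\neq j$, $xy$ is an edge iff $ij\in E(G)$. For a graph $H$ and $S\subseteq V(H)$: $S$ is dominating if every vertex outside $S$ has a neighbor in $S$; total dominating if every vertex of $H$ has a neighbor in $S$; a dominating set $S$ is restrained if every vertex outside $S$ has a neighbor outside $S$, and outer-connected if the subgraph induced by $V(H)\setminus S$ is connected. $\gamma,\gamma_t,\gamma_r,\gamma_{tr},\gamma^{oc},\gamma_t^{oc}$ denote the minimum cardinalities of, respectively, dominating, total dominating, restrained dominating, total restrained dominating (total and restrained), outer-connected dominating, and total outer-connected dominating (total and outer-connected) sets; a $\nu$-set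 is a set of the type corresponding to $\nu$ of cardinality $\nu(H)$. We write $\mu(H)\equiv\nu(H)$ (strongly equal) if the set of all $\mu$-sets of $H$ coincides with the set of all $\nu$-sets of $H$. *)

theory Defs
  imports "Graph_Theory.Graph_Theory" "HOL-Library.Extended_Nat"
begin

text \<open>
  A finite simple undirected graph is a \<open>pair_graph\<close>: an edge \<open>xy\<close> is represented by the two
  arcs \<open>(x, y)\<close> and \<open>(y, x)\<close>.
\<close>

definition lex_product :: "'i pair_pre_digraph \<Rightarrow> ('i \<Rightarrow> 'a pair_pre_digraph) \<Rightarrow> 'a pair_pre_digraph"
where
  "lex_product G F =
    \<lparr> pverts = (\<Union>i\<in>pverts G. pverts (F i)),
      parcs = (\<Union>i\<in>pverts G. parcs (F i)) \<union>
        {(x, y). \<exists>i\<in>pverts G. \<exists>j\<in>pverts G.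
           i \<noteq> j \<and> x \<in> pverts (F i) \<and> y \<in> pverts (F j) \<and> (i, j) \<in> parcs G} \<rparr>"

definition dominating :: "'a pair_pre_digraph \<Rightarrow> 'a set \<Rightarrow> bool" where
  "dominating H S \<longleftrightarrow> S \<subseteq> pverts H \<and> (\<forall>x\<in>pverts H - S. \<exists>y\<in>S. (x, y) \<in> parcs H)"

definition total_dominating :: "'a pair_pre_digraph \<Rightarrow> 'a set \<Rightarrow> bool" where
  "total_dominating H S \<longleftrightarrow> S \<subseteq> pverts H \<and> (\<forall>x\<in>pverts H. \<exists>y\<in>S. (x, y) \<in> parcs H)"

definition restrained_dominating :: "'a pair_pre_digraph \<Rightarrow> 'a set \<Rightarrow> bool" where
  "restrained_dominating H S \<longleftrightarrow>
     dominating H S \<and> (\<forall>x\<in>pverts H - S. \<exists>y\<in>pverts H - S. (x, y) \<in> parcs H)"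

text \<open>
  The library's \<open>connected\<close> does not hold of the graph without vertices, so the full vertex set
  does not count as outer-connected.
\<close>

definition outer_connected_dominating :: "'a pair_pre_digraph \<Rightarrow> 'a set \<Rightarrow> bool" where
  "outer_connected_dominating H S \<longleftrightarrow>
     dominating H S \<and> Digraph_Component.connected (with_proj H \<restriction> (pverts H - S))"

definition total_restrained_dominating :: "'a pair_pre_digraph \<Rightarrow> 'a set \<Rightarrow> bool" where
  "total_restrained_dominating H S \<longleftrightarrow> total_dominating H S \<and> restrained_dominating H S"

definition total_outer_connected_dominating :: "'a pair_pre_digraph \<Rightarrow> 'a set \<Rightarrow> bool" where
  "total_outer_connected_dominating H S \<longleftrightarrow> total_dominating H S \<and> outer_connected_dominating H S"

text \<open>
  The minimum cardinality of a set of type \<open>P\<close>. It is \<open>\<infinity>\<close> if there is no such set (for instance,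
  there is no total dominating set in a graph with an isolated vertex); hence an equation with a
  finite value includes the existence of a set of type \<open>P\<close>.
\<close>

definition dom_number ::
  "('a pair_pre_digraph \<Rightarrow> 'a set \<Rightarrow> bool) \<Rightarrow> 'a pair_pre_digraph \<Rightarrow> enat"
where
  "dom_number P H = (INF S\<in>{S. P H S}. enat (card S))"

definition gamma :: "'a pair_pre_digraph \<Rightarrow> enat" where
  "gamma = dom_number dominating"

definition gamma_r :: "'a pair_pre_digraph \<Rightarrow> enat" where
  "gamma_r = dom_number restrained_dominating"

definition gamma_t :: "'a pair_pre_digraph \<Rightarrow> enat" where
  "gamma_t = dom_number total_dominating"

definition gamma_tr :: "'a pair_pre_digraph \<Rightarrow> enat" where
  "gamma_tr = dom_number total_restrained_dominating"

definition gamma_oc :: "'a pair_pre_digraph \<Rightarrow> enat" where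
  "gamma_oc = dom_number outer_connected_dominating"

definition gamma_toc :: "'a pair_pre_digraph \<Rightarrow> enat" where
  "gamma_toc = dom_number total_outer_connected_dominating"

definition min_sets ::
  "('a pair_pre_digraph \<Rightarrow> 'a set \<Rightarrow> bool) \<Rightarrow> 'a pair_pre_digraph \<Rightarrow> 'a set set"
where
  "min_sets P H = {S. P H S \<and> enat (card S) = dom_number P H}"

text \<open>
  Strong equality of two parameters is a relation between the two types of sets, not between the
  two numbers, so its arguments are the predicates.
\<close>

definition strongly_equal ::
  "('a pair_pre_digraph \<Rightarrow> 'a set \<Rightarrow> bool) \<Rightarrow> ('a pair_pre_digraph \<Rightarrow> 'a set \<Rightarrow> bool) \<Rightarrow>
   'a pair_pre_digraph \<Rightarrow> bool"
where
  "strongly_equal P Q H \<longleftrightarrow> min_sets P H = min_sets Q H"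

lemma pair_graph_lex_product:
  assumes G: "pair_graph G"
    and F: "\<And>i. i \<in> pverts G \<Longrightarrow> pair_graph (F i)"
    and disj: "disjoint_family_on (\<lambda>i. pverts (F i)) (pverts G)"
  shows "pair_graph (lex_product G F)"
proof -
  interpret G: pair_graph G by (rule G)
  have arcD: "x \<in> pverts (F i) \<and> y \<in> pverts (F i) \<and> x \<noteq> y \<and> (y, x) \<in> parcs (F i)"
    if "i \<in> pverts G" "(x, y) \<in> parcs (F i)" for i x y
  proof -
    interpret Fi: pair_graph "F i" using that F by blast
    show ?thesis
      using that Fi.in_arcsD1 Fi.in_arcsD2 Fi.pair_no_loops[of "(x, y)"] Fi.pair_sym_arcs
      by (auto simp: symmetric_def sym_def)
  qed
  have symG: "(j, i) \<in> parcs G" if "(i, j) \<in> parcs G" for i j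
    using that G.pair_sym_arcs by (auto simp: symmetric_def sym_def)
  have fin: "finite (pverts (lex_product G F))"
    using F G.pair_finite_verts pair_fin_digraph.pair_finite_verts
    by (fastforce simp: lex_product_def pair_graph_def pair_digraph_def)
  have wf: "parcs (lex_product G F) \<subseteq> pverts (lex_product G F) \<times> pverts (lex_product G F)"
    using arcD by (auto simp: lex_product_def)
  have sym: "sym (parcs (lex_product G F))"
  proof (rule symI)
    fix x y assume "(x, y) \<in> parcs (lex_product G F)"
    then consider i where "i \<in> pverts G" "(x, y) \<in> parcs (F i)"
      | i j where "i \<in> pverts G" "j \<in> pverts G" "i \<noteq> j" "x \<in> pverts (F i)" "y \<in> pverts (F j)"
          "(i, j) \<in> parcs G"
      by (auto simp: lex_product_def)
    then show "(y, x) \<in> parcs (lex_product G F)"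
    proof cases
      case 1
      then show ?thesis using arcD by (auto simp: lex_product_def)
    next
      case 2
      then show ?thesis using symG[of i j] by (fastforce simp: lex_product_def)
    qed
  qed
  have irr: "x \<noteq> y" if xy: "(x, y) \<in> parcs (lex_product G F)" for x y
  proof
    assume "x = y"
    then consider i where "i \<in> pverts G" "(x, x) \<in> parcs (F i)"
      | i j where "i \<in> pverts G" "j \<in> pverts G" "i \<noteq> j" "x \<in> pverts (F i)" "x \<in> pverts (F j)"
      using xy by (auto simp: lex_product_def)
    then show False
      by cases (use arcD disjoint_family_onD[OF disj] in blast)+
  qed
  show ?thesis
    by unfold_locales
      (use wf fin sym irr in \<open>auto simp: symmetric_def intro: finite_subset[OF wf]\<close>)
qed

lemma lex_product_induces_factor:
  assumes F: "\<And>i. i \<in> pverts G \<Longrightarrow> pair_graph (F i)"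
    and disj: "disjoint_family_on (\<lambda>i. pverts (F i)) (pverts G)"
    and i: "i \<in> pverts G"
  shows "with_proj (lex_product G F) \<restriction> pverts (F i) = with_proj (F i)"
proof -
  have arcD: "x \<in> pverts (F j) \<and> y \<in> pverts (F j)"
    if "j \<in> pverts G" "(x, y) \<in> parcs (F j)" for j x y
  proof -
    interpret Fj: pair_graph "F j" using that F by blast
    show ?thesis using that Fj.in_arcsD1 Fj.in_arcsD2 by blast
  qed
  have eq: "j = k" if "j \<in> pverts G" "k \<in> pverts G" "x \<in> pverts (F j)" "x \<in> pverts (F k)" for j k x
    using that disjoint_family_onD[OF disj, of j k] by blast
  have "(x, y) \<in> parcs (F i) \<longleftrightarrow>
      (x, y) \<in> parcs (lex_product G F) \<and> x \<in> pverts (F i) \<and> y \<in> pverts (F i)" for x y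
  proof
    assume "(x, y) \<in> parcs (F i)"
    then show "(x, y) \<in> parcs (lex_product G F) \<and> x \<in> pverts (F i) \<and> y \<in> pverts (F i)"
      using arcD i by (auto simp: lex_product_def)
  next
    assume xy: "(x, y) \<in> parcs (lex_product G F) \<and> x \<in> pverts (F i) \<and> y \<in> pverts (F i)"
    then consider j where "j \<in> pverts G" "(x, y) \<in> parcs (F j)"
      | j k where "j \<in> pverts G" "k \<in> pverts G" "j \<noteq> k" "x \<in> pverts (F j)" "y \<in> pverts (F k)"
      by (auto simp: lex_product_def)
    then show "(x, y) \<in> parcs (F i)"
    proof cases
      case 1
      then show ?thesis using arcD eq i xy by metis
    next
      case 2
      then show ?thesis using eq i xy by metis
    qed
  qed
  then show ?thesis
    by (auto simp: induce_subgraph_def with_proj_def)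
qed

end

theory Submission
  imports Defs
begin

text \<open>
  Call a set \<open>D\<close> of vertices of \<open>G[\<Phi>]\<close> thin if it meets every factor in at most one vertex. When
  \<open>\<gamma>(F\<^sub>i) \<ge> 2\<close> for all \<open>i\<close>, a thin dominating set is total, since one vertex does not dominate its
  own factor, and its complement meets every factor and therefore inherits the connectedness of
  \<open>G\<close>. So all six parameters agree as soon as some minimum dominating set is thin.

  Suppose that \<open>D\<close> is dominating and meets \<open>F\<^sub>i\<close> in at least two vertices. Replacing \<open>D \<inter> F\<^sub>i\<close> by one
  of its vertices and one vertex of an adjacent factor \<open>F\<^sub>j\<close> leaves a dominating set. If \<open>D\<close> meets
  \<open>F\<^sub>j\<close>, choosing the second vertex in \<open>D\<close> makes the set smaller. If \<open>D\<close> misses all factors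
  adjacent to \<open>F\<^sub>i\<close>, the new set is not larger than \<open>D\<close> and meets more factors; moreover \<open>D \<inter> F\<^sub>i\<close>
  dominates \<open>F\<^sub>i\<close>, so the new set is smaller if \<open>\<gamma>(F\<^sub>i) \<ge> 3\<close>. Hence a minimum dominating set that
  meets as many factors as possible is thin, and every minimum dominating set is thin if
  \<open>\<gamma>(F\<^sub>i) \<ge> 3\<close> for all \<open>i\<close>.
\<close>

section \<open>Minimum cardinalities and minimum sets\<close>

lemma enat_le_dom_number_iff: "enat k \<le> dom_number P H \<longleftrightarrow> (\<forall>S. P H S \<longrightarrow> k \<le> card S)"
  by (auto simp: dom_number_def le_INF_iff)

lemma dom_number_le: "P H S \<Longrightarrow> dom_number P H \<le> enat (card S)"
  by (auto simp: dom_number_def intro: INF_lower)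

text \<open>Narrowing the type can only raise the minimum, and one minimum \<open>Q\<close>-set that
  has type \<open>P\<close> rules out a strict increase. Thus a single thin set settles each
  equation.\<close>

lemma dom_number_eqI:
  assumes "\<And>S. P H S \<Longrightarrow> Q H S" and "S \<in> min_sets Q H" and "P H S"
  shows "dom_number P H = dom_number Q H"
proof (rule antisym)
  show "dom_number P H \<le> dom_number Q H"
    using assms(2) dom_number_le[of P H S, OF assms(3)] by (simp add: min_sets_def)
  show "dom_number Q H \<le> dom_number P H"
    unfolding dom_number_def using assms(1) by (intro INF_superset_mono) auto
qed

text \<open>Nonemptiness supplies the witness for \<open>dom_number_eqI\<close>; once the two
  numbers agree, the sets attaining them can be compared.\<close>

lemma min_sets_eqI:
  assumes "\<And>S. P H S \<Longrightarrow> Q H S" and "\<And>S. S \<in> min_sets Q H \<Longrightarrow> P H S" and "min_sets Q H \<noteq> {}"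
  shows "min_sets P H = min_sets Q H"
proof -
  obtain S where "S \<in> min_sets Q H" using assms(3) by blast
  then have "dom_number P H = dom_number Q H" using assms(1,2) by (intro dom_number_eqI)
  then show ?thesis using assms(1,2) by (auto simp: min_sets_def)
qed

lemma min_sets_dominating_iff:
  "S \<in> min_sets dominating H \<longleftrightarrow>
    dominating H S \<and> (\<forall>T. dominating H T \<longrightarrow> card S \<le> card T)"
  using enat_le_dom_number_iff[of "card S" dominating H] dom_number_le[of dominating H S]
  by (auto simp: min_sets_def)

lemma min_sets_dominating_nonempty: "min_sets dominating H \<noteq> {}"
proof -
  have "dominating H (pverts H)" by (simp add: dominating_def)
  then obtain S where "dominating H S" "\<And>T. dominating H T \<Longrightarrow> card S \<le> card T"
    using ex_has_least_nat[of "dominating H" _ card] by blast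
  then show ?thesis using min_sets_dominating_iff by blast
qed

lemma total_dominating_imp_dominating: "total_dominating H S \<Longrightarrow> dominating H S"
  by (auto simp: total_dominating_def dominating_def)

section \<open>Cardinalities under an exchange of vertices\<close>

lemma card_exchange_le:
  assumes "finite D"
  shows "card (insert x (insert y (D - A))) + card (D \<inter> A) \<le> card D + 2"
proof -
  have "card (insert x (insert y (D - A))) \<le> card (D - A) + 2"
    using assms(1) by (simp add: card_insert_if)
  moreover have "card D = card (D - A) + card (D \<inter> A)"
    using assms(1) by (simp add: card_Diff_subset_Int card_mono)
  ultimately show ?thesis by linarith
qed

text \<open>A vertex \<open>y\<close> that survives in \<open>D - A\<close> costs nothing, so at
  most \<open>x\<close> is added while at least two vertices go.\<close>

lemma card_exchange_less:
  assumes "finite D" "2 \<le> card (D \<inter> A)" "y \<in> D - A"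
  shows "card (insert x (insert y (D - A))) < card D"
proof -
  have "insert y (D - A) = D - A" using assms(3) by blast
  then have "card (insert x (insert y (D - A))) \<le> card (D - A) + 1"
    using assms(1) by (simp add: card_insert_if)
  moreover have "card D = card (D - A) + card (D \<inter> A)"
    using assms(1) by (simp add: card_Diff_subset_Int card_mono)
  ultimately show ?thesis using assms(2) by linarith
qed

text \<open>The assumption \<open>gamma_F\<close> renders the lower bound 2 on the domination number
  of a factor as a bound on cardinalities, ready to apply to individual dominating sets.\<close>

locale connected_lex_product =
  fixes G :: "'i pair_pre_digraph" and F :: "'i \<Rightarrow> 'a pair_pre_digraph"
  assumes graph_G: "pair_graph G"
    and connected_G: "Digraph_Component.connected (with_proj G)"
    and card_G: "2 \<le> card (pverts G)"
    and graph_F: "\<And>i. i \<in> pverts G \<Longrightarrow> pair_graph (F i)"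
    and disjoint_F: "disjoint_family_on (\<lambda>i. pverts (F i)) (pverts G)"
    and gamma_F: "\<And>i S. i \<in> pverts G \<Longrightarrow> dominating (F i) S \<Longrightarrow> 2 \<le> card S"
begin

sublocale G: pair_graph G by (rule graph_G)

abbreviation H :: "'a pair_pre_digraph" where "H \<equiv> lex_product G F"

sublocale H: pair_graph H
  by (intro pair_graph_lex_product graph_G graph_F disjoint_F)

definition thin :: "'a set \<Rightarrow> bool" where
  "thin D \<longleftrightarrow> (\<forall>i\<in>pverts G. card (D \<inter> pverts (F i)) \<le> 1)"

definition support :: "'a set \<Rightarrow> 'i set" where
  "support D = {i \<in> pverts G. D \<inter> pverts (F i) \<noteq> {}}"

section \<open>Vertices and arcs of the product\<close>

lemma index_unique:
  "\<lbrakk>i \<in> pverts G; j \<in> pverts G; x \<in> pverts (F i); x \<in> pverts (F j)\<rbrakk> \<Longrightarrow> i = j"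
  using disjoint_family_onD[OF disjoint_F, of i j] by blast

lemma H_vertE:
  assumes "x \<in> pverts H"
  obtains i where "i \<in> pverts G" "x \<in> pverts (F i)"
  using assms by (auto simp: lex_product_def)

lemma H_vertI: "i \<in> pverts G \<Longrightarrow> x \<in> pverts (F i) \<Longrightarrow> x \<in> pverts H"
  by (auto simp: lex_product_def)

lemma finite_dominating: "dominating H D \<Longrightarrow> finite D"
  using H.pair_finite_verts by (auto simp: dominating_def intro: finite_subset)

lemma H_arcI:
  assumes "(i, j) \<in> parcs G" "x \<in> pverts (F i)" "y \<in> pverts (F j)"
  shows "(x, y) \<in> parcs H"
proof -
  have "i \<noteq> j" using assms(1) G.no_loops' by blast
  then show ?thesis
    using assms G.in_arcsD1[OF assms(1)] G.in_arcsD2[OF assms(1)] by (auto simp: lex_product_def)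
qed

lemma factor_arc_verts:
  "i \<in> pverts G \<Longrightarrow> (x, y) \<in> parcs (F i) \<Longrightarrow> x \<in> pverts (F i) \<and> y \<in> pverts (F i)"
  using graph_F[of i]
  by (auto simp: pair_graph_def pair_digraph_def pair_fin_digraph_def
      dest: pair_wf_digraph.in_arcsD1 pair_wf_digraph.in_arcsD2)

lemma H_arcE:
  assumes "(x, y) \<in> parcs H" "i \<in> pverts G" "x \<in> pverts (F i)"
  obtains (inner) "(x, y) \<in> parcs (F i)" "y \<in> pverts (F i)"
    | (outer) j where "(i, j) \<in> parcs G" "y \<in> pverts (F j)"
proof -
  consider k where "k \<in> pverts G" "(x, y) \<in> parcs (F k)"
    | k j where "k \<in> pverts G" "x \<in> pverts (F k)" "y \<in> pverts (F j)" "(k, j) \<in> parcs G"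
    using assms(1) by (auto simp: lex_product_def)
  then show thesis
  proof cases
    case 1
    then have "k = i" using assms factor_arc_verts index_unique by blast
    then show ?thesis using 1 inner factor_arc_verts by blast
  next
    case 2
    then have "k = i" using assms index_unique by blast
    then show ?thesis using 2 outer by blast
  qed
qed

text \<open>Since \<open>G\<close> is symmetric, its connectedness yields directed paths.\<close>

lemma reachable_G: "i \<in> pverts G \<Longrightarrow> j \<in> pverts G \<Longrightarrow> i \<rightarrow>\<^sup>*\<^bsub>with_proj G\<^esub> j"
  using G.symmetric_connected_imp_strongly_connected[OF G.pair_sym_arcs connected_G]
  by (auto simp: strongly_connected_def)

lemma ex_adjacent_index:
  assumes "i \<in> pverts G"
  obtains j where "(i, j) \<in> parcs G"
proof -
  obtain k where k: "k \<in> pverts G" "k \<noteq> i"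
    using card_G assms by (metis card_le_Suc0_iff_eq G.pair_finite_verts not_less_eq_eq numeral_2_eq_2)
  show thesis
    using reachable_G[OF assms k(1)] by (rule G.converse_reachable_cases) (use k that in auto)
qed

text \<open>In a graph without vertices the empty set is dominating, and it has fewer than two
  elements.\<close>

lemma factor_nonempty: "i \<in> pverts G \<Longrightarrow> \<exists>x. x \<in> pverts (F i)"
  using gamma_F[of i "{}"] by (auto simp: dominating_def)

text \<open>A neighbour of a vertex of \<open>F i\<close> lies in \<open>F i\<close> or in an
  adjacent factor, and \<open>D\<close> misses the latter.\<close>

lemma dominating_factor:
  assumes D: "dominating H D" and i: "i \<in> pverts G"
    and isolated: "\<And>j. (i, j) \<in> parcs G \<Longrightarrow> D \<inter> pverts (F j) = {}"
  shows "dominating (F i) (D \<inter> pverts (F i))"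
  unfolding dominating_def
proof (intro conjI ballI)
  fix x assume x: "x \<in> pverts (F i) - D \<inter> pverts (F i)"
  then have "x \<in> pverts H - D" using i H_vertI by blast
  then obtain y where y: "y \<in> D" "(x, y) \<in> parcs H"
    using D unfolding dominating_def by blast
  from y(2) i have "(x, y) \<in> parcs (F i) \<and> y \<in> pverts (F i)"
    by (rule H_arcE) (use x y isolated in auto)
  then show "\<exists>y\<in>D \<inter> pverts (F i). (x, y) \<in> parcs (F i)" using y by blast
qed simp

section \<open>Consequences of thinness\<close>

lemma thin_misses_vertex:
  assumes "thin D" "i \<in> pverts G"
  shows "\<exists>x. x \<in> pverts (F i) - D"
proof (rule ccontr)
  assume "\<nexists>x. x \<in> pverts (F i) - D"
  then have "D \<inter> pverts (F i) = pverts (F i)" by blast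
  then have "card (pverts (F i)) \<le> 1" using assms by (metis thin_def)
  \<comment> \<open>The full vertex set dominates the factor, so the bound applies to it.\<close>
  moreover have "2 \<le> card (pverts (F i))"
    using assms(2) by (intro gamma_F) (auto simp: dominating_def)
  ultimately show False by simp
qed

lemma thin_total:
  assumes D: "dominating H D" "thin D"
  shows "total_dominating H D"
  unfolding total_dominating_def
proof (intro conjI ballI)
  show "D \<subseteq> pverts H" using D by (simp add: dominating_def)
  fix x assume x: "x \<in> pverts H"
  obtain i where i: "i \<in> pverts G" "x \<in> pverts (F i)" using x by (rule H_vertE)
  have "card (D \<inter> pverts (F i)) < 2" using D(2) i by (auto simp: thin_def)
  then have "\<not> dominating (F i) (D \<inter> pverts (F i))" using gamma_F i by fastforce
  \<comment> \<open>By \<open>dominating_factor\<close>, \<open>D\<close> meets an adjacent factor;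
    a vertex of \<open>D\<close> there is a neighbour of every vertex of \<open>F i\<close>,
    including those in \<open>D\<close>.\<close>
  then obtain j where "(i, j) \<in> parcs G" "D \<inter> pverts (F j) \<noteq> {}"
    using dominating_factor[OF D(1) i(1)] by blast
  then show "\<exists>y\<in>D. (x, y) \<in> parcs H" using i H_arcI by blast
qed

lemma thin_restrained:
  assumes D: "dominating H D" "thin D"
  shows "restrained_dominating H D"
  unfolding restrained_dominating_def
proof (intro conjI ballI)
  fix x assume "x \<in> pverts H - D"
  then obtain i where i: "i \<in> pverts G" "x \<in> pverts (F i)" using H_vertE by blast
  obtain j where j: "(i, j) \<in> parcs G" using ex_adjacent_index i(1) .
  then obtain y where "y \<in> pverts (F j) - D"
    using thin_misses_vertex[OF D(2)] G.in_arcsD2 by blast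
  then show "\<exists>y\<in>pverts H - D. (x, y) \<in> parcs H"
    using i j H_arcI H_vertI G.in_arcsD2 by blast
qed (rule D)

lemma thin_outer_connected:
  assumes D: "dominating H D" "thin D"
  shows "outer_connected_dominating H D"
proof -
  let ?K = "with_proj H \<restriction> (pverts H - D)"
  interpret K: wf_digraph ?K by (intro H.wellformed_induce_subgraph)
  have adj: "x \<rightarrow>\<^bsub>?K\<^esub> y"
    if "(i, j) \<in> parcs G" "x \<in> pverts (F i) - D" "y \<in> pverts (F j) - D" for i j x y
  proof -
    have "(x, y) \<in> parcs H" using that H_arcI by blast
    moreover have "x \<in> pverts H" "y \<in> pverts H"
      using that G.in_arcsD1 G.in_arcsD2 H_vertI by blast+
    ultimately show ?thesis using that by (auto simp: arcs_ends_conv image_iff intro!: bexI[of _ "(x, y)"])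
  qed
  have missed: "\<exists>x. x \<in> pverts (F i) - D" if "i \<in> pverts G" for i
    using thin_misses_vertex[OF D(2) that] .
  have reach: "x \<rightarrow>\<^sup>*\<^bsub>?K\<^esub> y" if xy: "x \<in> pverts H - D" "y \<in> pverts H - D" for x y
  proof -
    obtain i where i: "i \<in> pverts G" "x \<in> pverts (F i) - D" using xy H_vertE by blast
    obtain j where j: "j \<in> pverts G" "y \<in> pverts (F j) - D" using xy H_vertE by blast
    \<comment> \<open>A walk in \<open>G\<close> is lifted factor by factor; the claim covers all
      remaining vertices of the current factor, so that it ends at \<open>y\<close> itself.\<close>
    have "\<forall>z\<in>pverts (F j) - D. x \<rightarrow>\<^sup>*\<^bsub>?K\<^esub> z"
      using reachable_G[OF i(1) j(1)]
    proof (induction rule: G.reachable_induct)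
      case base
      \<comment> \<open>\<open>F i\<close> may be disconnected, so the walk from \<open>x\<close> to
        \<open>z\<close> makes a detour through \<open>w\<close> in an adjacent factor.\<close>
      obtain k where k: "(i, k) \<in> parcs G" using ex_adjacent_index i(1) .
      then obtain w where w: "w \<in> pverts (F k) - D" using missed G.in_arcsD2 by blast
      have "x \<rightarrow>\<^sup>*\<^bsub>?K\<^esub> z" if "z \<in> pverts (F i) - D" for z
        using adj[OF k i(2) w] adj[OF G.arcs_symmetric[OF k] w that]
        by (blast intro: K.reachable_adjI K.reachable_adj_trans)
      then show ?case by blast
    next
      case (step k l)
      then have kl: "(k, l) \<in> parcs G" by simp
      then obtain w where w: "w \<in> pverts (F k) - D" using missed G.in_arcsD1 by blast
      show ?case using step.IH w adj[OF kl w] K.reachable_adj_trans by blast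
    qed
    then show ?thesis using j by blast
  qed
  have "pverts G \<noteq> {}" using card_G by auto
  then have ne: "pverts H - D \<noteq> {}" using missed H_vertI by blast
  \<comment> \<open>\<open>Digraph_Component.connected\<close> is strong connectedness of the
    symmetric closure, which includes nonemptiness.\<close>
  have "strongly_connected (mk_symmetric ?K)"
    using ne reach K.reachable_mk_symmetricI
    by (intro strongly_connectedI) (auto simp: mk_symmetric_def)
  then show ?thesis
    using D by (simp add: outer_connected_dominating_def Digraph_Component.connected_def)
qed

section \<open>Exchange of vertices in a dominating set\<close>

lemma dominating_exchange:
  assumes D: "dominating H D" and ij: "(i, j) \<in> parcs G"
    and x: "x \<in> D \<inter> pverts (F i)" and y: "y \<in> pverts (F j)"
  shows "dominating H (insert x (insert y (D - pverts (F i))))" (is "dominating H ?E")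
  unfolding dominating_def
proof (intro conjI ballI)
  have i: "i \<in> pverts G" and j: "j \<in> pverts G" using ij G.in_arcsD1 G.in_arcsD2 by blast+
  show "?E \<subseteq> pverts H" using D x y j H_vertI by (auto simp: dominating_def)
  fix z assume z: "z \<in> pverts H - ?E"
  obtain k where k: "k \<in> pverts G" "z \<in> pverts (F k)" using z H_vertE by blast
  show "\<exists>w\<in>?E. (z, w) \<in> parcs H"
  proof (cases "k = i")
    case True
    \<comment> \<open>\<open>y\<close> lies in an adjacent factor and so dominates all of
      \<open>F i\<close>.\<close>
    then show ?thesis using H_arcI[OF ij] k y by blast
  next
    case False
    then have "z \<notin> pverts (F i)" using index_unique i k by blast
    then obtain w where w: "w \<in> D" "(z, w) \<in> parcs H"
      using z D by (auto simp: dominating_def)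
    show ?thesis
    proof (cases "w \<in> pverts (F i)")
      case True
      \<comment> \<open>An arc from another factor into \<open>F i\<close> comes from an arc of
        \<open>G\<close>, so \<open>z\<close> is adjacent to all of \<open>F i\<close>, and
        \<open>x\<close> can replace \<open>w\<close>.\<close>
      from w(2) k have "(k, i) \<in> parcs G"
      proof (cases rule: H_arcE)
        case inner
        then show ?thesis using index_unique i k True False by blast
      next
        case (outer l)
        then have "l = i" using index_unique i True G.in_arcsD2 by blast
        then show ?thesis using outer by simp
      qed
      then show ?thesis using H_arcI k x by blast
    qed (use w in blast)
  qed
qed

text \<open>A vertex of \<open>D\<close> in \<open>F j\<close> would survive the exchange, which
  then keeps only \<open>x\<close> in place of at least two vertices.\<close>

lemma min_dominating_isolated:
  assumes D: "D \<in> min_sets dominating H" and ij: "(i, j) \<in> parcs G"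
    and two: "2 \<le> card (D \<inter> pverts (F i))"
  shows "D \<inter> pverts (F j) = {}"
proof (rule ccontr)
  assume "D \<inter> pverts (F j) \<noteq> {}"
  then obtain y where y: "y \<in> D" "y \<in> pverts (F j)" by blast
  obtain x where x: "x \<in> D \<inter> pverts (F i)" using two by (cases "D \<inter> pverts (F i) = {}") auto
  have dom: "dominating H D" using D by (simp add: min_sets_dominating_iff)
  have i: "i \<in> pverts G" "j \<in> pverts G" "i \<noteq> j"
    using ij G.in_arcsD1 G.in_arcsD2 G.no_loops' by blast+
  then have "y \<in> D - pverts (F i)" using y index_unique by blast
  then have "card (insert x (insert y (D - pverts (F i)))) < card D"
    using two finite_dominating[OF dom] by (intro card_exchange_less)
  then show False
    using D dominating_exchange[OF dom ij x y(2)] by (auto simp: min_sets_dominating_iff not_le[symmetric])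
qed

lemma ex_thin_min_dominating: "\<exists>D \<in> min_sets dominating H. thin D"
proof -
  have "\<exists>D. D \<in> min_sets dominating H" using min_sets_dominating_nonempty by blast
  \<comment> \<open>Supports are subsets of \<open>pverts G\<close>, so their sizes are bounded and
    a maximum exists.\<close>
  moreover have "card (support D) < Suc (card (pverts G))" for D
    by (auto simp: support_def less_Suc_eq_le intro!: card_mono G.pair_finite_verts)
  ultimately obtain D where D: "D \<in> min_sets dominating H"
    and max: "\<And>E. E \<in> min_sets dominating H \<Longrightarrow> card (support E) \<le> card (support D)"
    using ex_has_greatest_nat[of "\<lambda>D. D \<in> min_sets dominating H" _ "\<lambda>D. card (support D)"]
    by (metis less_imp_le)
  have dom: "dominating H D" using D by (simp add: min_sets_dominating_iff)
  have "card (D \<inter> pverts (F i)) \<le> 1" if i: "i \<in> pverts G" for i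
  proof (rule ccontr)
    assume "\<not> card (D \<inter> pverts (F i)) \<le> 1"
    then have two: "2 \<le> card (D \<inter> pverts (F i))" by simp
    obtain j where ij: "(i, j) \<in> parcs G" using ex_adjacent_index i .
    have j: "j \<in> pverts G" using ij G.in_arcsD2 by blast
    obtain x where x: "x \<in> D \<inter> pverts (F i)" using two by (cases "D \<inter> pverts (F i) = {}") auto
    obtain y where y: "y \<in> pverts (F j)" using factor_nonempty j by blast
    let ?E = "insert x (insert y (D - pverts (F i)))"
    have "dominating H ?E" by (rule dominating_exchange[OF dom ij x y])
    moreover have "card ?E \<le> card D"
      using card_exchange_le[OF finite_dominating[OF dom], of x y "pverts (F i)"] two by linarith
    ultimately have "?E \<in> min_sets dominating H"
      using D by (auto simp: min_sets_dominating_iff intro: order_trans)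
    \<comment> \<open>\<open>x\<close> keeps \<open>F i\<close> met, the other factors lose nothing,
      and \<open>F j\<close> is newly met.\<close>
    moreover have "support D \<subset> support ?E"
    proof
      show "support D \<subseteq> support ?E"
        using x i index_unique by (fastforce simp: support_def)
      have "j \<in> support ?E" "j \<notin> support D"
        using j y min_dominating_isolated[OF D ij two] by (auto simp: support_def)
      then show "support D \<noteq> support ?E" by blast
    qed
    moreover have "finite (support ?E)" using G.pair_finite_verts by (simp add: support_def)
    ultimately show False using max psubset_card_mono leD by blast
  qed
  then show ?thesis using D by (auto simp: thin_def)
qed

lemma min_dominating_thin:
  assumes gamma3: "\<And>i S. i \<in> pverts G \<Longrightarrow> dominating (F i) S \<Longrightarrow> 3 \<le> card S"
    and D: "D \<in> min_sets dominating H"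
  shows "thin D"
  unfolding thin_def
proof (rule ballI, rule ccontr)
  fix i assume i: "i \<in> pverts G" and "\<not> card (D \<inter> pverts (F i)) \<le> 1"
  then have two: "2 \<le> card (D \<inter> pverts (F i))" by simp
  have dom: "dominating H D" using D by (simp add: min_sets_dominating_iff)
  \<comment> \<open>\<open>D\<close> misses every adjacent factor, so
    \<open>D \<inter> pverts (F i)\<close> dominates \<open>F i\<close> on its own and the bound 3
    applies to it.\<close>
  have three: "3 \<le> card (D \<inter> pverts (F i))"
    using gamma3 i dominating_factor[OF dom i] min_dominating_isolated[OF D _ two] by blast
  obtain j where ij: "(i, j) \<in> parcs G" using ex_adjacent_index i .
  obtain x where x: "x \<in> D \<inter> pverts (F i)" using two by (cases "D \<inter> pverts (F i) = {}") auto
  obtain y where y: "y \<in> pverts (F j)" using factor_nonempty ij G.in_arcsD2 by blast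
  have "card D \<le> card (insert x (insert y (D - pverts (F i))))"
    using D dominating_exchange[OF dom ij x y] by (simp add: min_sets_dominating_iff)
  then show False
    using card_exchange_le[OF finite_dominating[OF dom], of x y "pverts (F i)"] three by linarith
qed

section \<open>Equality and strong equality of the parameters\<close>

lemma dom_numbers_eq_gamma:
  "gamma_r H = gamma H" "gamma_t H = gamma H" "gamma_tr H = gamma H"
  "gamma_oc H = gamma H" "gamma_toc H = gamma H"
proof -
  obtain D where D: "D \<in> min_sets dominating H" "thin D" using ex_thin_min_dominating by blast
  have dom: "dominating H D" using D by (simp add: min_sets_dominating_iff)
  note types = restrained_dominating_def total_restrained_dominating_def
    outer_connected_dominating_def total_outer_connected_dominating_def
  note thin = thin_total[OF dom D(2)] thin_restrained[OF dom D(2)] thin_outer_connected[OF dom D(2)]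
  show "gamma_r H = gamma H" unfolding gamma_r_def gamma_def
    by (rule dom_number_eqI[OF _ D(1)]) (use thin in \<open>simp_all add: types\<close>)
  show "gamma_t H = gamma H" unfolding gamma_t_def gamma_def
    by (rule dom_number_eqI[OF _ D(1)]) (use thin in \<open>simp_all add: total_dominating_imp_dominating\<close>)
  show "gamma_tr H = gamma H" unfolding gamma_tr_def gamma_def
    by (rule dom_number_eqI[OF _ D(1)]) (use thin in \<open>simp_all add: types\<close>)
  show "gamma_oc H = gamma H" unfolding gamma_oc_def gamma_def
    by (rule dom_number_eqI[OF _ D(1)]) (use thin in \<open>simp_all add: types\<close>)
  show "gamma_toc H = gamma H" unfolding gamma_toc_def gamma_def
    by (rule dom_number_eqI[OF _ D(1)]) (use thin in \<open>simp_all add: types\<close>)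
qed

text \<open>Under the bound 3 all minimum dominating sets are thin, not just one; this is what
  \<open>min_sets_eqI\<close> requires beyond \<open>dom_number_eqI\<close>.\<close>

lemma min_sets_eq_min_dominating:
  assumes "\<And>i S. i \<in> pverts G \<Longrightarrow> dominating (F i) S \<Longrightarrow> 3 \<le> card S"
  shows "min_sets restrained_dominating H = min_sets dominating H"
    "min_sets total_dominating H = min_sets dominating H"
    "min_sets total_restrained_dominating H = min_sets dominating H"
    "min_sets outer_connected_dominating H = min_sets dominating H"
    "min_sets total_outer_connected_dominating H = min_sets dominating H"
proof -
  note types = restrained_dominating_def total_restrained_dominating_def
    outer_connected_dominating_def total_outer_connected_dominating_def
  have thin: "total_dominating H D" "restrained_dominating H D" "outer_connected_dominating H D"
    if "D \<in> min_sets dominating H" for D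
    using that min_dominating_thin[OF assms that] thin_total thin_restrained thin_outer_connected
    by (simp_all add: min_sets_dominating_iff)
  note eqI = min_sets_eqI[OF _ _ min_sets_dominating_nonempty]
  show "min_sets restrained_dominating H = min_sets dominating H"
    by (rule eqI) (use thin in \<open>simp_all add: types\<close>)
  show "min_sets total_dominating H = min_sets dominating H"
    by (rule eqI) (use thin in \<open>simp_all add: total_dominating_imp_dominating\<close>)
  show "min_sets total_restrained_dominating H = min_sets dominating H"
    by (rule eqI) (use thin in \<open>simp_all add: types\<close>)
  show "min_sets outer_connected_dominating H = min_sets dominating H"
    by (rule eqI) (use thin in \<open>simp_all add: types\<close>)
  show "min_sets total_outer_connected_dominating H = min_sets dominating H"
    by (rule eqI) (use thin in \<open>simp_all add: types\<close>)
qed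

end

theorem theorem2p9:
  fixes n :: nat
    and G :: "nat pair_pre_digraph"
    and F :: "nat \<Rightarrow> 'a pair_pre_digraph"
  assumes "n \<ge> 2"
    and "pair_graph G"
    and "pverts G = {1..n}"
    and "Digraph_Component.connected (with_proj G)"
    and "\<And>i. i \<in> {1..n} \<Longrightarrow> pair_graph (F i)"
    and "disjoint_family_on (\<lambda>i. pverts (F i)) {1..n}"
  shows "let H = lex_product G F in
    ((\<forall>i\<in>{1..n}. gamma (F i) \<ge> 2) \<longrightarrow>
       gamma H = gamma_r H \<and> gamma_r H = gamma_t H \<and> gamma_t H = gamma_tr H \<and>
       gamma_tr H = gamma_oc H \<and> gamma_oc H = gamma_toc H) \<and>
    ((\<forall>i\<in>{1..n}. gamma (F i) \<ge> 3) \<longrightarrow>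
       strongly_equal dominating restrained_dominating H \<and>
       strongly_equal restrained_dominating total_dominating H \<and>
       strongly_equal total_dominating total_restrained_dominating H \<and>
       strongly_equal total_restrained_dominating outer_connected_dominating H \<and>
       strongly_equal outer_connected_dominating total_outer_connected_dominating H)"
proof -
  \<comment> \<open>An arbitrary numeral serves both bounds, 2 and 3.\<close>
  have card_ge: "numeral k \<le> card S"
    if "\<forall>i\<in>{1..n}. numeral k \<le> gamma (F i)" "i \<in> pverts G" "dominating (F i) S" for k i S
    using that enat_le_dom_number_iff[of "numeral k" dominating "F i"] assms(3)
    by (auto simp: gamma_def numeral_eq_enat)
  have product: "connected_lex_product G F"
    if "\<And>i S. i \<in> pverts G \<Longrightarrow> dominating (F i) S \<Longrightarrow> 2 \<le> card S"
    using assms that by (intro connected_lex_product.intro) simp_all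
  have "gamma (lex_product G F) = gamma_r (lex_product G F) \<and>
      gamma_r (lex_product G F) = gamma_t (lex_product G F) \<and>
      gamma_t (lex_product G F) = gamma_tr (lex_product G F) \<and>
      gamma_tr (lex_product G F) = gamma_oc (lex_product G F) \<and>
      gamma_oc (lex_product G F) = gamma_toc (lex_product G F)"
    if "\<forall>i\<in>{1..n}. 2 \<le> gamma (F i)"
  proof -
    interpret connected_lex_product G F by (rule product) (rule card_ge[OF that])
    show ?thesis by (simp add: dom_numbers_eq_gamma)
  qed
  moreover have "strongly_equal dominating restrained_dominating (lex_product G F) \<and>
      strongly_equal restrained_dominating total_dominating (lex_product G F) \<and>
      strongly_equal total_dominating total_restrained_dominating (lex_product G F) \<and>
      strongly_equal total_restrained_dominating outer_connected_dominating (lex_product G F) \<and>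
      strongly_equal outer_connected_dominating total_outer_connected_dominating (lex_product G F)"
    if "\<forall>i\<in>{1..n}. 3 \<le> gamma (F i)"
  proof -
    note three = card_ge[OF that]
    \<comment> \<open>The bound 3 implies the bound 2 that the locale assumes.\<close>
    interpret connected_lex_product G F by (rule product) (rule order_trans[OF _ three], simp_all)
    show ?thesis by (simp add: strongly_equal_def min_sets_eq_min_dominating[OF three])
  qed
  ultimately show ?thesis by (simp add: Let_def)
qed

end
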